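(* Let $Y=Y_1+\dots+Y_n$, where $Y_1,\dots,Y_n$ are independent zero-mean random variables such that, for some positive real numbers $\sigma_1,\dots,\sigma_n$, $$\mathsf{E}e^{\lambda Y_i}\le e^{\lambda^2\sigma_i^2/2}\quad\text{for all } i\in\{1,\dots,n\}\text{ and all real }\lambda\ge0 .$$ Let $\sigma:=\sqrt{\sigma_1^2+\dots+\sigma_n^2}$. Then for all real $y>0$, with $t:=y/\sigma$, $\mu_t:=e^{t^2/2}$ and $v_t:=e^{t^2}$, $$\mathsf{P}(Y\ge y)\le\min\Big(1,\frac{\mu_t-1}{v_t-1-\ln v_t}\Big)=\min\Big(1,\frac{e^{t^2/2}-1}{e^{t^2}-1-t^2}\Big).$$
   Context: $\mathsf{P}$ and $\mathsf{E}$ denote probability and expectation. *)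

theory Defs
  imports "HOL-Probability.Probability"
begin

end

theory Submission
  imports Defs
begin

text \<open>The variable \<open>exp (\<lambda>Y) - 1 - \<lambda>Y\<close> is nonnegative, and since \<open>Y\<close> has mean zero its expectation
  equals \<open>\<E> exp (\<lambda>Y) - 1\<close>, which is one less than in the usual Chernoff argument. Markov's
  inequality for this variable with \<open>\<lambda> = y / \<sigma>\<^sup>2\<close>, so that \<open>\<lambda>y = t\<^sup>2\<close>, gives the bound.\<close>

text \<open>The derivative \<open>exp x - 1\<close> is nonnegative for x \<ge> 0. Without calculus:
  factoring out \<open>exp a\<close> \<ge> 1 leaves \<open>exp (b - a) - 1\<close>, which is at
  least \<open>b - a\<close>. The sign condition on \<open>a\<close> matters, since
  \<open>exp x - x\<close> decreases on the negative axis.\<close>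

lemma exp_minus_self_mono:
  fixes a b :: real
  assumes "0 \<le> a" "a \<le> b"
  shows "exp a - a \<le> exp b - b"
proof -
  have "b - a \<le> 1 * (exp (b - a) - 1)"
    using exp_ge_add_one_self[of "b - a"] unfolding mult_1 by linarith
  also have "\<dots> \<le> exp a * (exp (b - a) - 1)"
    using assms by (intro mult_right_mono) auto
  also have "\<dots> = exp b - exp a"
    by (simp add: algebra_simps flip: exp_add)
  finally show ?thesis by simp
qed

lemma (in prob_space) prob_ge_le_mgf_minus_one:
  assumes int: "integrable M X" and mean: "expectation X = 0"
    and int_exp: "integrable M (\<lambda>\<omega>. exp (l * X \<omega>))"
    and l: "l > 0" and y: "y > 0"
  shows "prob {\<omega> \<in> space M. X \<omega> \<ge> y}
           \<le> (expectation (\<lambda>\<omega>. exp (l * X \<omega>)) - 1) / (exp (l * y) - 1 - l * y)"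
proof -
  define g where "g x = exp x - 1 - x" for x :: real
  have ly: "l * y > 0" using l y by simp
  have g_nonneg: "g x \<ge> 0" for x
    using exp_ge_add_one_self[of x] unfolding g_def by linarith
  \<comment> \<open>Markov's inequality divides by this value, so strictness is required; it comes
    from the quadratic Taylor term, \<open>g x\<close> \<ge> x^2/2 for x \<ge> 0.\<close>
  have g_pos: "g (l * y) > 0"
    using exp_lower_Taylor_quadratic[OF less_imp_le[OF ly]] zero_less_power[OF ly, of 2]
    unfolding g_def by linarith
  have int_g: "integrable M (\<lambda>\<omega>. g (l * X \<omega>))"
    unfolding g_def using int int_exp by auto
  have g_mono: "g (l * y) \<le> g (l * x)" if "y \<le> x" for x
    using exp_minus_self_mono[of "l * y" "l * x"] that l ly
    by (simp add: g_def)
  have [measurable]: "X \<in> borel_measurable M" using int by auto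
  have [measurable]: "g \<in> borel_measurable borel" unfolding g_def by measurable
  \<comment> \<open>Only an inclusion of events: \<open>g\<close> is not monotone on the whole line,
    so the right-hand event may also contain points where \<open>X\<close> is very negative.\<close>
  have "prob {\<omega> \<in> space M. X \<omega> \<ge> y} \<le> prob {\<omega> \<in> space M. g (l * X \<omega>) \<ge> g (l * y)}"
    by (intro finite_measure_mono) (auto intro: g_mono)
  also have "\<dots> \<le> expectation (\<lambda>\<omega>. g (l * X \<omega>)) / g (l * y)"
    using int_g g_pos by (intro integral_Markov_inequality_measure[where A = "space M"])
      (auto simp: g_nonneg)
  also have "expectation (\<lambda>\<omega>. g (l * X \<omega>)) = expectation (\<lambda>\<omega>. exp (l * X \<omega>)) - 1"
    unfolding g_def using int int_exp mean by (simp add: prob_space)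
  finally show ?thesis by (simp add: g_def)
qed

text \<open>Independence survives the map x -> \<open>exp (l * x)\<close>, which turns the sum into
  a product, and expectations of independent integrable factors multiply.\<close>

lemma (in prob_space)
  fixes X :: "'i \<Rightarrow> 'a \<Rightarrow> real"
  assumes fin: "finite I" and indep: "indep_vars (\<lambda>_. borel) X I"
    and int: "\<And>i. i \<in> I \<Longrightarrow> integrable M (\<lambda>\<omega>. exp (l * X i \<omega>))"
  shows integrable_exp_sum_indep: "integrable M (\<lambda>\<omega>. exp (l * (\<Sum>i\<in>I. X i \<omega>)))"
    and expectation_exp_sum_indep:
      "expectation (\<lambda>\<omega>. exp (l * (\<Sum>i\<in>I. X i \<omega>))) = (\<Prod>i\<in>I. expectation (\<lambda>\<omega>. exp (l * X i \<omega>)))"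
proof -
  have indep_exp: "indep_vars (\<lambda>_. borel) (\<lambda>i \<omega>. exp (l * X i \<omega>)) I"
    by (rule indep_vars_compose2[OF indep]) measurable
  have exp_sum: "exp (l * (\<Sum>i\<in>I. X i \<omega>)) = (\<Prod>i\<in>I. exp (l * X i \<omega>))" for \<omega>
    using fin by (simp add: sum_distrib_left exp_sum)
  show "integrable M (\<lambda>\<omega>. exp (l * (\<Sum>i\<in>I. X i \<omega>)))"
    unfolding exp_sum by (rule indep_vars_integrable[OF fin indep_exp int])
  show "expectation (\<lambda>\<omega>. exp (l * (\<Sum>i\<in>I. X i \<omega>))) = (\<Prod>i\<in>I. expectation (\<lambda>\<omega>. exp (l * X i \<omega>)))"
    unfolding exp_sum by (rule indep_vars_lebesgue_integral[OF fin indep_exp int])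
qed

theorem proposition3p3:
  fixes M :: "'a measure" and Y :: "nat \<Rightarrow> 'a \<Rightarrow> real"
    and s :: "nat \<Rightarrow> real" and n :: nat and y :: real
  assumes "prob_space M"
    and "n \<ge> 1"
    and "prob_space.indep_vars M (\<lambda>_. borel) Y {1..n}"
    and "\<And>i. i \<in> {1..n} \<Longrightarrow> integrable M (Y i)"
    and "\<And>i. i \<in> {1..n} \<Longrightarrow> prob_space.expectation M (Y i) = 0"
    and "\<And>i. i \<in> {1..n} \<Longrightarrow> s i > 0"
    and "\<And>i l. i \<in> {1..n} \<Longrightarrow> l \<ge> 0 \<Longrightarrow> integrable M (\<lambda>\<omega>. exp (l * Y i \<omega>))"
    and "\<And>i l. i \<in> {1..n} \<Longrightarrow> l \<ge> 0 \<Longrightarrow>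
           prob_space.expectation M (\<lambda>\<omega>. exp (l * Y i \<omega>)) \<le> exp (l\<^sup>2 * (s i)\<^sup>2 / 2)"
    and "y > 0"
  shows "let \<sigma> = sqrt (\<Sum>i=1..n. (s i)\<^sup>2);
             t = y / \<sigma>;
             \<mu> = exp (t\<^sup>2 / 2);
             v = exp (t\<^sup>2)
         in prob_space.prob M {\<omega> \<in> space M. (\<Sum>i=1..n. Y i \<omega>) \<ge> y}
              \<le> min 1 ((\<mu> - 1) / (v - 1 - ln v)) \<and>
            min 1 ((\<mu> - 1) / (v - 1 - ln v))
              = min 1 ((exp (t\<^sup>2 / 2) - 1) / (exp (t\<^sup>2) - 1 - t\<^sup>2))"
proof -
  interpret prob_space M by fact
  define V where "V = (\<Sum>i=1..n. (s i)\<^sup>2)"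
  define t where "t = y / sqrt V"
  \<comment> \<open>This is the minimiser of the Chernoff exponent
    \<open>l\<^sup>2 * V / 2 - l * y\<close>. It makes both \<open>l * y\<close> and
    \<open>l\<^sup>2 * V\<close> equal to \<open>t\<^sup>2\<close>.\<close>
  define l where "l = y / V"
  define X where "X \<omega> = (\<Sum>i=1..n. Y i \<omega>)" for \<omega>
  \<comment> \<open>As n \<ge> 1, the sum of positive squares is nonempty, so the divisions defining
    \<open>t\<close> and \<open>l\<close> are genuine.\<close>
  have V: "V > 0"
    unfolding V_def using assms(2,6) by (intro sum_pos) (auto simp: less_imp_neq[symmetric])
  have l: "l > 0"
    using V assms(9) by (simp add: l_def)
  have t2: "t\<^sup>2 = l * y" and l2: "l\<^sup>2 * V = t\<^sup>2"
    using V by (simp_all add: t_def l_def power2_eq_square)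
  have int_exp: "integrable M (\<lambda>\<omega>. exp (l * X \<omega>))"
    unfolding X_def using assms(3,7) l by (intro integrable_exp_sum_indep) auto
  have "expectation (\<lambda>\<omega>. exp (l * X \<omega>)) = (\<Prod>i=1..n. expectation (\<lambda>\<omega>. exp (l * Y i \<omega>)))"
    unfolding X_def using assms(3,7) l by (intro expectation_exp_sum_indep) auto
  also have "\<dots> \<le> (\<Prod>i=1..n. exp (l\<^sup>2 * (s i)\<^sup>2 / 2))"
    using assms(8) l by (intro prod_mono) auto
  also have "\<dots> = exp (l\<^sup>2 * V / 2)"
    by (simp add: V_def sum_distrib_left sum_divide_distrib flip: exp_sum)
  finally have mgf: "expectation (\<lambda>\<omega>. exp (l * X \<omega>)) \<le> exp (t\<^sup>2 / 2)"
    by (simp add: l2)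
  have "integrable M X" "expectation X = 0"
    unfolding X_def using assms(4,5) by auto
  then have "prob {\<omega> \<in> space M. X \<omega> \<ge> y}
      \<le> (expectation (\<lambda>\<omega>. exp (l * X \<omega>)) - 1) / (exp (l * y) - 1 - l * y)"
    using int_exp l assms(9) by (intro prob_ge_le_mgf_minus_one) auto
  \<comment> \<open>The denominators agree because \<open>l * y\<close> is \<open>t\<^sup>2\<close>;
    only the numerator is enlarged, through \<open>mgf\<close>.\<close>
  also have "\<dots> \<le> (exp (t\<^sup>2 / 2) - 1) / (exp (t\<^sup>2) - 1 - t\<^sup>2)"
    unfolding t2[symmetric]
  proof (rule divide_right_mono)
    show "0 \<le> exp (t\<^sup>2) - 1 - t\<^sup>2"
      using exp_ge_add_one_self[of "t\<^sup>2"] by linarith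
  qed (use mgf in simp)
  \<comment> \<open>The bound by 1 holds for any probability, and
    \<open>ln (exp (t\<^sup>2))\<close> = \<open>t\<^sup>2\<close> identifies the two forms of the
    quotient.\<close>
  finally show ?thesis
    unfolding Let_def V_def[symmetric] t_def[symmetric] X_def[symmetric]
    by (simp only: ln_exp) simp
qed

end
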